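(* Let $\Gamma_B$ be the branching graph of the rook-Brauer algebras (with explicit description given in the context) and $(\Omega_{\Gamma_B},\mathcal{F}_{\Gamma_B})$ its space of infinite paths. Identify the path space $(\Omega_{\mathbb{Y}},\mathcal{F}_{\mathbb{Y}})$ of the Young graph $\mathbb{Y}$ with the Borel subspace of $\Omega_{\Gamma_B}$ consisting of those infinite paths $((n,\lambda_n))_{n\ge0}$ that only use forward moves $\lambda_{n+1}=\lambda_n+\Box$ (equivalently, $|\lambda_n|=n$ for all $n$). Then any central measure on $(\Omega_{\Gamma_B},\mathcal{F}_{\Gamma_B})$ is fully supported on $(\Omega_{\mathbb{Y}},\mathcal{F}_{\mathbb{Y}})$, i.e. gives measure $1$ to $\Omega_{\mathbb{Y}}$.
   Context: $\mathbb{Y}_k$ is the set of Young diagrams with $k$ boxes, $\mathbb{Y}_0=\{\emptyset\}$, $|\lambda|$ is the number of boxes of $\lambda$, and $\lambda\pm\Box$ denotes a diagram obtained from $\lambda$ by adding/removing one box. The Young graph $\mathbb{Y}$ has level-$n$ vertex set $\mathbb{Y}_n$ with one edge between $\lambda\in\mathbb{Y}_n$ and $\mu\in\mathbb{Y}_{n+1}$ iff $\mu=\lambda+\Box$. $\Gamma_B$ is the graded graph whose level-$n$ vertex set is $V_n=\{n\}\times\bigcup_{k=0}^n\mathbb{Y}_k$, $n\ge0$, with one edge between $(n,\lambda)\in V_n$ and $(n-1,\mu)\in V_{n-1}$ iff $\lambda=\mu$, $\lambda=\mu+\Box$ or $\lambda=\mu-\Box$. The root is $(0,\emptyset)$. (It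 is the branching graph of the tower of rook-Brauer algebras at generic parameter.) For a graded graph $\Gamma$ with root and levels $\Gamma_n$, write $\gamma\nearrow\tilde\gamma$ if $\gamma\in\Gamma_n$, $\tilde\gamma\in\Gamma_{n+1}$ are joined by an edge; $\dim_\Gamma(\gamma)$ is the number of level-increasing paths from the root to $\gamma$; $\Omega_\Gamma\subset\prod_n\Gamma_n$ is the space of infinite paths $\gamma_0\nearrow\gamma_1\nearrow\cdots$ from the root with the restriction $\mathcal{F}_\Gamma$ of the product $\sigma$-algebra. A probability measure $\mathbb{P}$ on $(\Omega_\Gamma,\mathcal{F}_\Gamma)$ is central if for every $n\ge0$, $\gamma\in\Gamma_n$ and path $\gamma_0\nearrow\cdots\nearrow\gamma_n=\gamma$ from the root, $\mathbb{P}(\omega_1=\gamma_1,\dots,\omega_n=\gamma)=\mathbb{P}(\omega_n=\gamma)/\dim_\Gamma(\gamma)$. *)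

theory Defs
  imports "HOL-Probability.Probability"
begin

text \<open>
  A graded graph; \<open>edge\<close> is oriented towards increasing level, and only its restriction to
  consecutive levels matters, see \<open>nearrow\<close>.
\<close>
record 'v graded_graph =
  level :: "nat \<Rightarrow> 'v set"
  edge :: "'v \<Rightarrow> 'v \<Rightarrow> bool"
  base :: 'v

definition nearrow :: "'v graded_graph \<Rightarrow> 'v \<Rightarrow> 'v \<Rightarrow> bool" where
  "nearrow \<Gamma> \<gamma> \<gamma>' \<longleftrightarrow> (\<exists>n. \<gamma> \<in> level \<Gamma> n \<and> \<gamma>' \<in> level \<Gamma> (Suc n) \<and> edge \<Gamma> \<gamma> \<gamma>')"

text \<open>The level \<open>n\<close> of \<open>\<gamma>\<close> is passed explicitly. Paths are extensional functions
  on \<open>{0..n}\<close>, so that their number is the cardinality of this set.\<close>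
definition finite_paths :: "'v graded_graph \<Rightarrow> nat \<Rightarrow> 'v \<Rightarrow> (nat \<Rightarrow> 'v) set" where
  "finite_paths \<Gamma> n \<gamma> =
     {p \<in> PiE {0..n} (level \<Gamma>).
        p 0 = base \<Gamma> \<and> p n = \<gamma> \<and> (\<forall>k<n. nearrow \<Gamma> (p k) (p (Suc k)))}"

definition dim_graph :: "'v graded_graph \<Rightarrow> nat \<Rightarrow> 'v \<Rightarrow> nat" where
  "dim_graph \<Gamma> n \<gamma> = card (finite_paths \<Gamma> n \<gamma>)"

definition infinite_paths :: "'v graded_graph \<Rightarrow> (nat \<Rightarrow> 'v) set" where
  "infinite_paths \<Gamma> =
     {\<omega> \<in> PiE UNIV (level \<Gamma>). \<omega> 0 = base \<Gamma> \<and> (\<forall>n. nearrow \<Gamma> (\<omega> n) (\<omega> (Suc n)))}"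

text \<open>The measurable space \<open>(\<Omega>\<^sub>\<Gamma>, F\<^sub>\<Gamma>)\<close>; the measure it carries as an object of type
  \<open>measure\<close> is irrelevant.\<close>
definition path_space :: "'v graded_graph \<Rightarrow> (nat \<Rightarrow> 'v) measure" where
  "path_space \<Gamma> =
     restrict_space (PiM UNIV (\<lambda>n. count_space (level \<Gamma> n))) (infinite_paths \<Gamma>)"

definition central_measure :: "'v graded_graph \<Rightarrow> (nat \<Rightarrow> 'v) measure \<Rightarrow> bool" where
  "central_measure \<Gamma> P \<longleftrightarrow>
     prob_space P \<and> sets P = sets (path_space \<Gamma>) \<and>
     (\<forall>n. \<forall>\<gamma>\<in>level \<Gamma> n. \<forall>p\<in>finite_paths \<Gamma> n \<gamma>.
        measure P {\<omega> \<in> space P. \<forall>k\<in>{1..n}. \<omega> k = p k} =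
        measure P {\<omega> \<in> space P. \<omega> n = \<gamma>} / real (dim_graph \<Gamma> n \<gamma>))"

text \<open>Young diagrams are finite sets of boxes \<open>(row, column)\<close>, indexed from \<open>0\<close>.\<close>
type_synonym diagram = "(nat \<times> nat) set"

definition young_diagram :: "diagram \<Rightarrow> bool" where
  "young_diagram D \<longleftrightarrow>
     finite D \<and> (\<forall>i j i' j'. (i, j) \<in> D \<longrightarrow> i' \<le> i \<longrightarrow> j' \<le> j \<longrightarrow> (i', j') \<in> D)"

definition young_diagrams :: "nat \<Rightarrow> diagram set" where
  "young_diagrams k = {D. young_diagram D \<and> card D = k}"

text \<open>\<open>add_box \<lambda> \<mu>\<close> means \<open>\<mu> = \<lambda> + \<box>\<close>, equivalently \<open>\<lambda> = \<mu> - \<box>\<close>.\<close>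
definition add_box :: "diagram \<Rightarrow> diagram \<Rightarrow> bool" where
  "add_box D E \<longleftrightarrow> young_diagram D \<and> young_diagram E \<and> (\<exists>b. b \<notin> D \<and> E = insert b D)"

definition young_graph :: "diagram graded_graph" where
  "young_graph = \<lparr>level = young_diagrams, edge = add_box, base = {}\<rparr>"

definition rook_brauer_graph :: "(nat \<times> diagram) graded_graph" where
  "rook_brauer_graph =
     \<lparr>level = (\<lambda>n. {n} \<times> (\<Union>k\<in>{0..n}. young_diagrams k)),
      edge = (\<lambda>(m, D) (n, E). n = Suc m \<and> (E = D \<or> add_box D E \<or> add_box E D)),
      base = (0, {})\<rparr>"

text \<open>The identification of \<open>\<Omega>\<close> of the Young graph with a subspace of \<open>\<Omega>\<close> of the
  rook-Brauer graph.\<close>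
definition young_embedding :: "(nat \<Rightarrow> diagram) \<Rightarrow> nat \<Rightarrow> nat \<times> diagram" where
  "young_embedding \<omega> = (\<lambda>n. (n, \<omega> n))"

definition forward_paths :: "(nat \<Rightarrow> nat \<times> diagram) set" where
  "forward_paths =
     {\<omega> \<in> infinite_paths rook_brauer_graph. \<forall>n. add_box (snd (\<omega> n)) (snd (\<omega> (Suc n)))}"

end

theory Submission
  imports Defs
begin

text \<open>
  Write \<open>W n \<lambda>\<close> for the number of walks of length \<open>n\<close> from the empty diagram to \<open>\<lambda>\<close> that at each step
  add a box, remove a box or stay. This is the dimension of the vertex \<open>(n, \<lambda>)\<close> of the rook-Brauer
  graph. Why a central measure does not charge a vertex \<open>(m, \<mu>)\<close> with \<open>|\<mu>| < m\<close>: a walk through it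
  has wasted at least one of its first \<open>m\<close> steps, because \<open>\<mu>\<close> can be reached in \<open>|\<mu>|\<close> steps.
  Replacing the first \<open>m\<close> steps by such a shortest walk shows that the number of walks from \<open>(m, \<mu>)\<close>
  to \<open>(n, \<lambda>)\<close> is at most \<open>W (|\<mu>| + n - m) \<lambda> \<le> W (n - 1) \<lambda>\<close>, and it turns out that
  \<open>W (n - 1) \<lambda> \<le> W n \<lambda> / \<surd>n\<close> uniformly in \<open>\<lambda>\<close>.

  Under a central measure all paths from the root to a vertex \<open>\<gamma>\<close> of level \<open>n\<close> have the same
  probability \<open>w n \<gamma>\<close>, and splitting a cylinder according to its next vertex makes \<open>w\<close> harmonic
  (\<open>path_weight_harmonic\<close>). Iterating this from level \<open>m\<close> to level \<open>n\<close> gives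
  \<open>w m (m, \<mu>) \<le> (\<Sum>\<lambda>. w n (n, \<lambda>) * W (|\<mu>| + n - m) \<lambda>)\<close> (\<open>path_weight_le_walks\<close>). By the bound on \<open>W\<close>,
  the right-hand side is at most \<open>1 / \<surd>n\<close> times \<open>(\<Sum>\<lambda>. w n (n, \<lambda>) * W n \<lambda>)\<close>, which is the total
  mass of level \<open>n\<close>. Letting \<open>n\<close> grow, \<open>w m (m, \<mu>) = 0\<close> (\<open>path_weight_eq_0\<close>). There are countably
  many such vertices, so almost every path satisfies \<open>|\<lambda>\<^sub>n| = n\<close> for all \<open>n\<close>, that is, it only moves
  forward.

  The uniform bound (\<open>walk_count_growth\<close>) comes from the closed formula
  \<open>W n \<lambda> = f \<lambda> * (n choose |\<lambda>|) * t (n - |\<lambda>|)\<close> (\<open>walk_count_eq\<close>), where \<open>f \<lambda>\<close> is the number of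
  standard tableaux and \<open>t d\<close> the number of involutions of a \<open>d\<close>-element set. It rests on
  Stanley's commutation relation \<open>DU - UD = I\<close> for adding (\<open>U\<close>) and removing (\<open>D\<close>) boxes on Young's
  lattice (\<open>young_lattice_commutation\<close>), and on \<open>\<surd>d * t (d - 1) \<le> t d\<close>.
\<close>

section \<open>Young's lattice\<close>

lemma young_diagramD:
  "young_diagram D \<Longrightarrow> (i, j) \<in> D \<Longrightarrow> i' \<le> i \<Longrightarrow> j' \<le> j \<Longrightarrow> (i', j') \<in> D"
  unfolding young_diagram_def by blast

lemma finite_young_diagram: "young_diagram D \<Longrightarrow> finite D"
  unfolding young_diagram_def by blast

lemma young_diagram_Un: "young_diagram D \<Longrightarrow> young_diagram E \<Longrightarrow> young_diagram (D \<union> E)"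
  unfolding young_diagram_def Un_iff finite_Un by blast

lemma young_diagram_Int: "young_diagram D \<Longrightarrow> young_diagram E \<Longrightarrow> young_diagram (D \<inter> E)"
  unfolding young_diagram_def Int_iff by (blast intro: finite_Int)

lemma young_diagram_empty [simp]: "young_diagram {}"
  by (simp add: young_diagram_def)

lemma card_add_box: "add_box D E \<Longrightarrow> card E = Suc (card D)"
  unfolding add_box_def using finite_young_diagram by auto

lemma finite_young_diagrams: "finite (young_diagrams k)"
proof (rule finite_subset)
  show "young_diagrams k \<subseteq> Pow ({..<k} \<times> {..<k})"
  proof clarsimp
    fix D i j assume D: "D \<in> young_diagrams k" and ij: "(i, j) \<in> D"
    have y: "young_diagram D" "finite D" "card D = k"
      using D finite_young_diagram by (auto simp: young_diagrams_def)
    have "{..i} \<times> {j} \<subseteq> D" "{i} \<times> {..j} \<subseteq> D"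
      using young_diagramD[OF y(1) ij] by auto
    from this[THEN card_mono[OF y(2)]] show "i < k \<and> j < k"
      by (simp add: y(3) card_cartesian_product)
  qed
qed simp

definition covers_above :: "diagram \<Rightarrow> diagram set" where
  "covers_above D = {E. add_box D E}"

definition covers_below :: "diagram \<Rightarrow> diagram set" where
  "covers_below E = {D. add_box D E}"

lemma covers_below_empty [simp]: "covers_below {} = {}"
  by (auto simp: covers_below_def add_box_def)

lemma covers_aboveD:
  "E \<in> covers_above D \<Longrightarrow> young_diagram E \<and> card E = Suc (card D)"
  using card_add_box[of D E] by (auto simp: covers_above_def add_box_def)

lemma covers_belowD:
  "D \<in> covers_below E \<Longrightarrow> young_diagram D \<and> card E = Suc (card D)"
  using card_add_box[of D E] by (auto simp: covers_below_def add_box_def)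

lemma finite_covers_above: "finite (covers_above D)"
  by (rule finite_subset[OF _ finite_young_diagrams[of "Suc (card D)"]])
    (auto simp: young_diagrams_def dest: covers_aboveD)

lemma finite_covers_below: "finite (covers_below E)"
  by (rule finite_subset[OF _ finite_young_diagrams[of "card E - 1"]])
    (auto simp: young_diagrams_def dest: covers_belowD)

definition row_length :: "diagram \<Rightarrow> nat \<Rightarrow> nat" where
  "row_length D i = card {j. (i, j) \<in> D}"

lemma mem_young_diagram_iff:
  assumes "young_diagram D"
  shows "(i, j) \<in> D \<longleftrightarrow> j < row_length D i"
proof -
  let ?S = "{j. (i, j) \<in> D}"
  have fin: "finite ?S"
    by (rule finite_subset[OF _ finite_imageI[OF finite_young_diagram[OF assms], of snd]]) force
  have "?S = {..<card ?S}"
  proof (cases "?S = {}")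
    case False
    have "?S = {..Max ?S}"
      using Max_in[OF fin False] Max_ge[OF fin] young_diagramD[OF assms] by blast
    then show ?thesis
      by (metis card_atMost lessThan_Suc_atMost)
  qed simp
  then show ?thesis
    unfolding row_length_def by blast
qed

text \<open>A box can only be added at the end of the first row or of a row strictly shorter than the one
  above. The set of rows is written so that it is visibly the set of removable rows of the next
  lemma, shifted by one, together with the first row.\<close>
lemma bij_betw_addable_rows:
  assumes D: "young_diagram D"
  shows "bij_betw (\<lambda>i. insert (i, row_length D i) D)
    (insert 0 (Suc ` {i. row_length D (Suc i) < row_length D i})) (covers_above D)"
proof (rule bij_betw_imageI)
  note mem = mem_young_diagram_iff[OF D]
  show "inj_on (\<lambda>i. insert (i, row_length D i) D)
      (insert 0 (Suc ` {i. row_length D (Suc i) < row_length D i}))"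
  proof (rule inj_onI)
    fix i i' assume "insert (i, row_length D i) D = insert (i', row_length D i') D"
    then have "(i, row_length D i) \<in> insert (i', row_length D i') D" by blast
    then show "i = i'" by (auto simp: mem)
  qed
  show "(\<lambda>i. insert (i, row_length D i) D) `
      insert 0 (Suc ` {i. row_length D (Suc i) < row_length D i}) = covers_above D"
  proof (intro equalityI subsetI)
    fix E assume "E \<in> (\<lambda>i. insert (i, row_length D i) D) `
      insert 0 (Suc ` {i. row_length D (Suc i) < row_length D i})"
    then obtain a where a: "E = insert (a, row_length D a) D"
      and ok: "a = 0 \<or> (\<exists>i. a = Suc i \<and> row_length D (Suc i) < row_length D i)" by auto
    have "(x', y') \<in> E" if "(x, y) \<in> E" "x' \<le> x" "y' \<le> y" for x y x' y'
    proof (cases "(x, y) \<in> D")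
      case True
      then show ?thesis using young_diagramD[OF D True] that a by blast
    next
      case False
      then have xy: "x = a" "y = row_length D a" using that a by auto
      show ?thesis
      proof (cases "x' = a")
        case True
        then show ?thesis using a xy that mem by (cases "y' = y") auto
      next
        case False
        with ok xy that obtain i where i: "a = Suc i" "row_length D (Suc i) < row_length D i"
          by auto
        then have "(i, y) \<in> D" using xy mem by auto
        then show ?thesis using young_diagramD[OF D, of i y x' y'] False xy i that a by auto
      qed
    qed
    then have "young_diagram E"
      using finite_young_diagram[OF D] a unfolding young_diagram_def by blast
    moreover have "(a, row_length D a) \<notin> D" by (simp add: mem)
    ultimately show "E \<in> covers_above D"
      using D a by (auto simp: covers_above_def add_box_def)
  next
    fix E assume "E \<in> covers_above D"
    then obtain a b where E: "young_diagram E" "E = insert (a, b) D" "(a, b) \<notin> D"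
      by (auto simp: covers_above_def add_box_def)
    have "(a, row_length D a) \<in> E"
      using young_diagramD[OF E(1), of a b a "row_length D a"] E mem by (auto simp: not_less)
    then have b: "b = row_length D a" using E mem by auto
    have "row_length D (Suc i) < row_length D i" if "a = Suc i" for i
    proof -
      have "(i, b) \<in> E" using young_diagramD[OF E(1), of a b i b] E that by auto
      then show ?thesis using E that b mem by auto
    qed
    then have "a \<in> insert 0 (Suc ` {i. row_length D (Suc i) < row_length D i})"
      by (cases a) auto
    then show "E \<in> (\<lambda>i. insert (i, row_length D i) D) `
      insert 0 (Suc ` {i. row_length D (Suc i) < row_length D i})"
      using E b by blast
  qed
qed

lemma bij_betw_removable_rows:
  assumes D: "young_diagram D"
  shows "bij_betw (\<lambda>i. D - {(i, row_length D i - 1)})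
    {i. row_length D (Suc i) < row_length D i} (covers_below D)"
proof (rule bij_betw_imageI)
  note mem = mem_young_diagram_iff[OF D]
  show "inj_on (\<lambda>i. D - {(i, row_length D i - 1)}) {i. row_length D (Suc i) < row_length D i}"
  proof (rule inj_onI)
    fix i i' assume i: "i \<in> {i. row_length D (Suc i) < row_length D i}"
      and eq: "D - {(i, row_length D i - 1)} = D - {(i', row_length D i' - 1)}"
    have "(i, row_length D i - 1) \<in> D" using i by (auto simp: mem)
    then have "(i, row_length D i - 1) = (i', row_length D i' - 1)" using eq by blast
    then show "i = i'" by simp
  qed
  show "(\<lambda>i. D - {(i, row_length D i - 1)}) ` {i. row_length D (Suc i) < row_length D i}
      = covers_below D"
  proof (intro equalityI subsetI)
    fix E assume "E \<in> (\<lambda>i. D - {(i, row_length D i - 1)}) `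
      {i. row_length D (Suc i) < row_length D i}"
    then obtain a where a: "E = D - {(a, row_length D a - 1)}"
      and less: "row_length D (Suc a) < row_length D a" by auto
    have "(x', y') \<in> E" if "(x, y) \<in> E" "x' \<le> x" "y' \<le> y" for x y x' y'
    proof (rule ccontr)
      assume no: "(x', y') \<notin> E"
      have xy: "(x, y) \<in> D" using that a by auto
      then have "(x', y') \<in> D" using young_diagramD[OF D] that by blast
      with no a have eq: "x' = a" "y' = row_length D a - 1" by auto
      show False
      proof (cases "x = a")
        case True
        then show False using that a eq xy mem by auto
      next
        case False
        then have "(Suc a, y') \<in> D" using young_diagramD[OF D xy, of "Suc a" y'] that eq by auto
        then show False using mem eq less by auto
      qed
    qed
    then have "young_diagram E"
      using finite_young_diagram[OF D] a unfolding young_diagram_def by blast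
    moreover have "(a, row_length D a - 1) \<in> D" using less by (simp add: mem)
    then have "(a, row_length D a - 1) \<notin> E \<and> D = insert (a, row_length D a - 1) E"
      using a by blast
    ultimately show "E \<in> covers_below D"
      using D unfolding covers_below_def add_box_def by blast
  next
    fix E assume "E \<in> covers_below D"
    then obtain a b where E: "young_diagram E" "D = insert (a, b) E" "(a, b) \<notin> E"
      by (auto simp: covers_below_def add_box_def)
    have "(a, Suc b) \<notin> D" "(Suc a, b) \<notin> D"
      using young_diagramD[OF E(1), of a "Suc b" a b] young_diagramD[OF E(1), of "Suc a" b a b] E
      by auto
    moreover have "(a, b) \<in> D" using E by auto
    ultimately have "b = row_length D a - 1" "row_length D (Suc a) < row_length D a"
      by (auto simp: mem)
    moreover have "E = D - {(a, b)}" using E by auto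
    ultimately show "E \<in> (\<lambda>i. D - {(i, row_length D i - 1)}) `
      {i. row_length D (Suc i) < row_length D i}"
      by blast
  qed
qed

text \<open>This excess of one is the source of the identity in the commutation relation.\<close>
lemma card_covers_above:
  assumes "young_diagram D"
  shows "card (covers_above D) = Suc (card (covers_below D))"
proof -
  let ?R = "{i. row_length D (Suc i) < row_length D i}"
  have "finite ?R"
    using bij_betw_finite[OF bij_betw_removable_rows[OF assms]] finite_covers_below by simp
  then have "card (insert 0 (Suc ` ?R)) = Suc (card ?R)"
    by (simp add: card_image)
  then show ?thesis
    using bij_betw_same_card[OF bij_betw_addable_rows[OF assms]]
      bij_betw_same_card[OF bij_betw_removable_rows[OF assms]] by simp
qed

text \<open>Two distinct diagrams of equal size have at most one common cover, their union, and at most one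
  common diagram covered by both, their intersection, and one exists iff the other does. So the
  off-diagonal entries of \<open>DU\<close> and \<open>UD\<close> agree.\<close>
lemma common_cover_eq:
  assumes "add_box D F" "add_box E F" "D \<noteq> E"
  shows "F = D \<union> E" "add_box (D \<inter> E) D" "add_box (D \<inter> E) E"
proof -
  obtain x y where xy: "x \<notin> D" "F = insert x D" "y \<notin> E" "F = insert y E"
    and y: "young_diagram D" "young_diagram E"
    using assms by (auto simp: add_box_def)
  then have "x \<noteq> y" using assms by auto
  then show "F = D \<union> E" using xy by auto
  have "D = insert y (D \<inter> E)" "E = insert x (D \<inter> E)" "x \<notin> D \<inter> E" "y \<notin> D \<inter> E"
    using xy \<open>x \<noteq> y\<close> by auto
  then show "add_box (D \<inter> E) D" "add_box (D \<inter> E) E"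
    using y young_diagram_Int unfolding add_box_def by blast+
qed

lemma common_cocover_eq:
  assumes "add_box C D" "add_box C E" "D \<noteq> E"
  shows "C = D \<inter> E" "add_box D (D \<union> E)" "add_box E (D \<union> E)"
proof -
  obtain x y where xy: "x \<notin> C" "D = insert x C" "y \<notin> C" "E = insert y C"
    and y: "young_diagram D" "young_diagram E"
    using assms by (auto simp: add_box_def)
  then have "x \<noteq> y" using assms by auto
  then show "C = D \<inter> E" using xy by auto
  have "D \<union> E = insert y D" "D \<union> E = insert x E" "y \<notin> D" "x \<notin> E"
    using xy \<open>x \<noteq> y\<close> by auto
  then show "add_box D (D \<union> E)" "add_box E (D \<union> E)"
    using y young_diagram_Un[OF y] unfolding add_box_def by blast+
qed

lemma sum_split_at:
  fixes h :: "'a \<Rightarrow> 'b :: comm_semiring_1"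
  assumes "finite A" "\<And>x. x \<in> A \<Longrightarrow> finite (B x)" "\<And>x. x \<in> A \<Longrightarrow> a \<in> B x"
  shows "(\<Sum>x\<in>A. \<Sum>y\<in>B x. h y) = of_nat (card A) * h a + (\<Sum>x\<in>A. \<Sum>y\<in>B x - {a}. h y)"
proof -
  have "(\<Sum>y\<in>B x. h y) = h a + (\<Sum>y\<in>B x - {a}. h y)" if "x \<in> A" for x
    using assms that by (intro sum.remove) auto
  then show ?thesis by (simp add: sum.distrib)
qed

text \<open>The relation \<open>DU - UD = I\<close>, evaluated against a function \<open>h\<close>. The terms with \<open>E \<noteq> D\<close> on the two
  sides are matched by \<open>(D \<union> E, E) \<leftrightarrow> (D \<inter> E, E)\<close>; the terms with \<open>E = D\<close> count the covers of \<open>D\<close> and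
  the diagrams covered by \<open>D\<close>.\<close>
lemma young_lattice_commutation:
  fixes h :: "diagram \<Rightarrow> 'b :: comm_semiring_1"
  assumes D: "young_diagram D"
  shows "(\<Sum>F\<in>covers_above D. \<Sum>E\<in>covers_below F. h E)
    = h D + (\<Sum>C\<in>covers_below D. \<Sum>E\<in>covers_above C. h E)"
proof -
  have off: "(\<Sum>F\<in>covers_above D. \<Sum>E\<in>covers_below F - {D}. h E)
      = (\<Sum>C\<in>covers_below D. \<Sum>E\<in>covers_above C - {D}. h E)"
    unfolding sum.Sigma[OF finite_covers_above ballI[OF finite_Diff[OF finite_covers_below]]]
      sum.Sigma[OF finite_covers_below ballI[OF finite_Diff[OF finite_covers_above]]]
  proof (rule sum.reindex_bij_witness[where i = "\<lambda>(C, E). (D \<union> E, E)"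
        and j = "\<lambda>(F, E). (D \<inter> E, E)"])
    fix p assume p: "p \<in> (SIGMA F:covers_above D. covers_below F - {D})"
    obtain F E where FE: "p = (F, E)" "add_box D F" "add_box E F" "D \<noteq> E"
      using p by (auto simp: covers_above_def covers_below_def)
    from common_cover_eq[OF FE(2-4)] FE
    show "(case case p of (F, E) \<Rightarrow> (D \<inter> E, E) of (C, E) \<Rightarrow> (D \<union> E, E)) = p"
      "(case p of (F, E) \<Rightarrow> (D \<inter> E, E)) \<in> (SIGMA C:covers_below D. covers_above C - {D})"
      "(case case p of (F, E) \<Rightarrow> (D \<inter> E, E) of (C, E) \<Rightarrow> h E) = (case p of (F, E) \<Rightarrow> h E)"
      by (simp_all add: covers_above_def covers_below_def)
  next
    fix p assume p: "p \<in> (SIGMA C:covers_below D. covers_above C - {D})"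
    obtain C E where CE: "p = (C, E)" "add_box C D" "add_box C E" "D \<noteq> E"
      using p by (auto simp: covers_above_def covers_below_def)
    from common_cocover_eq[OF CE(2-4)] CE
    show "(case case p of (C, E) \<Rightarrow> (D \<union> E, E) of (F, E) \<Rightarrow> (D \<inter> E, E)) = p"
      "(case p of (C, E) \<Rightarrow> (D \<union> E, E)) \<in> (SIGMA F:covers_above D. covers_below F - {D})"
      by (simp_all add: covers_above_def covers_below_def)
  qed
  have above: "(\<Sum>F\<in>covers_above D. \<Sum>E\<in>covers_below F. h E)
      = of_nat (card (covers_above D)) * h D + (\<Sum>F\<in>covers_above D. \<Sum>E\<in>covers_below F - {D}. h E)"
    by (rule sum_split_at) (auto simp: finite_covers_above finite_covers_below,
        auto simp: covers_above_def covers_below_def)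
  have below: "(\<Sum>C\<in>covers_below D. \<Sum>E\<in>covers_above C. h E)
      = of_nat (card (covers_below D)) * h D + (\<Sum>C\<in>covers_below D. \<Sum>E\<in>covers_above C - {D}. h E)"
    by (rule sum_split_at) (auto simp: finite_covers_above finite_covers_below,
        auto simp: covers_above_def covers_below_def)
  show ?thesis
    unfolding above below off card_covers_above[OF D]
    by (simp only: of_nat_Suc distrib_right mult_1_left add.assoc)
qed

section \<open>Counting walks on Young's lattice\<close>

text \<open>For \<open>k = |D|\<close> this counts the saturated chains from the empty diagram to \<open>D\<close>, that is, the
  standard Young tableaux of shape \<open>D\<close>; otherwise it is \<open>0\<close>.\<close>
primrec tableau_count :: "nat \<Rightarrow> diagram \<Rightarrow> nat" where
  "tableau_count 0 D = of_bool (D = {})"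
| "tableau_count (Suc k) D = (\<Sum>C\<in>covers_below D. tableau_count k C)"

text \<open>With \<open>f\<close> for \<open>tableau_count\<close>, the sum over the covers of \<open>D\<close> is \<open>f D\<close> plus, by the commutation
  relation and the induction hypothesis, \<open>k\<close> times the sum of \<open>f\<close> over the diagrams covered by \<open>D\<close>,
  which is \<open>k * f D\<close>.\<close>
lemma sum_tableau_count_above:
  assumes "young_diagram D" "card D = k"
  shows "(\<Sum>F\<in>covers_above D. tableau_count (Suc k) F) = Suc k * tableau_count k D"
  using assms
proof (induction k arbitrary: D)
  case 0
  then have "D = {}" using finite_young_diagram by auto
  then show ?case
    using young_lattice_commutation[OF 0(1), of "tableau_count 0"] by simp
next
  case (Suc k)
  have "(\<Sum>E\<in>covers_above C. tableau_count (Suc k) E) = Suc k * tableau_count k C"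
    if "C \<in> covers_below D" for C
    using Suc covers_belowD[OF that] by auto
  then have "(\<Sum>C\<in>covers_below D. \<Sum>E\<in>covers_above C. tableau_count (Suc k) E)
      = Suc k * tableau_count (Suc k) D"
    by (simp add: sum_distrib_left)
  with young_lattice_commutation[OF Suc(2), of "tableau_count (Suc k)"] show ?case
    by simp
qed

text \<open>A box \<open>(a, b)\<close> maximising \<open>a + b\<close> can be removed.\<close>
lemma covers_below_nonempty:
  assumes D: "young_diagram D" and "D \<noteq> {}"
  shows "covers_below D \<noteq> {}"
proof -
  have fin: "finite ((\<lambda>(i, j). i + j) ` D)" and ne: "(\<lambda>(i, j). i + j) ` D \<noteq> {}"
    using finite_young_diagram[OF D] assms(2) by auto
  obtain a b where ab: "(a, b) \<in> D" "a + b = Max ((\<lambda>(i, j). i + j) ` D)"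
    using Max_in[OF fin ne] by auto
  have max: "x + y \<le> a + b" if "(x, y) \<in> D" for x y
    using Max_ge[OF fin] that unfolding ab(2) by force
  have "(x', y') \<in> D - {(a, b)}" if xy: "(x, y) \<in> D - {(a, b)}" "x' \<le> x" "y' \<le> y" for x y x' y'
  proof -
    have "(x', y') \<in> D" using young_diagramD[OF D] xy by blast
    moreover have "(x', y') \<noteq> (a, b)" using max[of x y] xy by auto
    ultimately show ?thesis by blast
  qed
  then have "young_diagram (D - {(a, b)})"
    using finite_young_diagram[OF D] unfolding young_diagram_def by blast
  moreover have "D = insert (a, b) (D - {(a, b)})" "(a, b) \<notin> D - {(a, b)}" using ab by auto
  ultimately have "add_box (D - {(a, b)}) D"
    using D unfolding add_box_def by blast
  then show ?thesis by (auto simp: covers_below_def)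
qed

lemma tableau_count_pos: "young_diagram D \<Longrightarrow> tableau_count (card D) D > 0"
proof (induction "card D" arbitrary: D)
  case 0
  then show ?case using finite_young_diagram by auto
next
  case (Suc k)
  then obtain C where C: "C \<in> covers_below D"
    using covers_below_nonempty[of D] by force
  then have "young_diagram C" "card C = k"
    using covers_belowD[OF C] Suc(2) by auto
  with Suc(1)[of C] C show ?case
    unfolding Suc(2)[symmetric] by (auto simp: finite_covers_below sum_pos2)
qed

definition lattice_moves :: "diagram \<Rightarrow> diagram set" where
  "lattice_moves D = insert D (covers_above D \<union> covers_below D)"

lemma finite_lattice_moves: "finite (lattice_moves D)"
  by (simp add: lattice_moves_def finite_covers_above finite_covers_below)

lemma young_diagram_lattice_moves:
  "young_diagram D \<Longrightarrow> E \<in> lattice_moves D \<Longrightarrow> young_diagram E"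
  by (auto simp: lattice_moves_def dest: covers_aboveD covers_belowD)

lemma sum_lattice_moves:
  "(\<Sum>E\<in>lattice_moves D. h E)
    = h D + (\<Sum>E\<in>covers_above D. h E) + (\<Sum>E\<in>covers_below D. h E)"
proof -
  have "D \<notin> covers_above D \<union> covers_below D" "covers_above D \<inter> covers_below D = {}"
    using covers_aboveD covers_belowD by fastforce+
  then show ?thesis
    by (simp add: lattice_moves_def sum.union_disjoint finite_covers_above finite_covers_below
        ac_simps)
qed

primrec walk_count :: "nat \<Rightarrow> diagram \<Rightarrow> nat" where
  "walk_count 0 D = of_bool (D = {})"
| "walk_count (Suc n) D = (\<Sum>E\<in>lattice_moves D. walk_count n E)"

text \<open>The number of involutions of a \<open>d\<close>-element set: the last element is either fixed or exchanged
  with one of the others.\<close>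
fun involution_number :: "nat \<Rightarrow> nat" where
  "involution_number 0 = 1"
| "involution_number (Suc 0) = 1"
| "involution_number (Suc (Suc d)) = involution_number (Suc d) + Suc d * involution_number d"

lemma involution_number_pos: "involution_number d > 0"
  by (induction d rule: involution_number.induct) auto

text \<open>For \<open>d = 0\<close> the truncated index \<open>d - 1\<close> is harmless because of the factor \<open>d\<close>.\<close>
lemma involution_number_Suc:
  "involution_number (Suc d) = involution_number d + d * involution_number (d - 1)"
  by (cases d) auto

text \<open>Behind the formula is a correspondence of Robinson-Schensted type: walks correspond to a subset of
  the times, a standard tableau of shape \<open>D\<close> on this subset, and an involution of the remaining times.
  The proof checks instead that the formula satisfies the recursion of \<open>walk_count\<close>. Let \<open>l = card D\<close>
  and \<open>d = n - l\<close>, and leave out the common factor \<open>tableau_count l D\<close>. In the main case \<open>0 < l \<le> n\<close>, the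
  stays and the covers of \<open>D\<close> together contribute \<open>(n choose l) * t (d + 1)\<close>, by the recursion of the
  involution numbers \<open>t\<close>; the diagrams covered by \<open>D\<close> contribute \<open>(n choose (l - 1)) * t (d + 1)\<close>; and
  Pascal's rule adds the two.\<close>
lemma walk_count_eq:
  assumes "young_diagram D"
  shows "walk_count n D
    = tableau_count (card D) D * (n choose card D) * involution_number (n - card D)"
  using assms
proof (induction n arbitrary: D)
  case 0
  then show ?case using finite_young_diagram[of D] by (cases "D = {}") (auto simp: card_gt_0_iff)
next
  case (Suc n)
  define l where "l = card D"
  define f where "f = tableau_count l D"
  have above: "(\<Sum>E\<in>covers_above D. walk_count n E)
      = Suc l * f * (n choose Suc l) * involution_number (n - Suc l)"
  proof -
    have "(\<Sum>E\<in>covers_above D. walk_count n E)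
      = (\<Sum>E\<in>covers_above D. tableau_count (Suc l) E * (n choose Suc l) * involution_number (n - Suc l))"
      using Suc.IH covers_aboveD by (intro sum.cong) (auto simp: l_def)
    also have "\<dots> = (\<Sum>E\<in>covers_above D. tableau_count (Suc l) E) * (n choose Suc l)
        * involution_number (n - Suc l)"
      by (simp only: sum_distrib_right)
    finally show ?thesis
      using sum_tableau_count_above[OF Suc.prems, of l] by (simp add: l_def f_def)
  qed
  have goal: "walk_count (Suc n) D = f * (Suc n choose l) * involution_number (Suc n - l)"
  proof (cases l)
    case 0
    then have D: "D = {}" using l_def finite_young_diagram[OF Suc.prems] by auto
    then have "walk_count n D = f * involution_number n"
      using Suc.IH[of D] by (simp add: f_def l_def)
    with above show ?thesis
      by (simp add: sum_lattice_moves 0 D f_def involution_number_Suc algebra_simps del: involution_number.simps)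
  next
    case (Suc l')
    have below: "(\<Sum>E\<in>covers_below D. walk_count n E)
        = f * (n choose l') * involution_number (n - l')"
    proof -
      have "(\<Sum>E\<in>covers_below D. walk_count n E)
        = (\<Sum>E\<in>covers_below D. tableau_count l' E * (n choose l') * involution_number (n - l'))"
        using Suc.IH covers_belowD Suc by (intro sum.cong) (fastforce simp: l_def)+
      then show ?thesis by (simp add: f_def Suc sum_distrib_right)
    qed
    have stay: "walk_count n D = f * (n choose l) * involution_number (n - l)"
      using Suc.IH[OF Suc.prems] by (simp add: f_def l_def)
    show ?thesis
    proof (cases "n < l")
      case True
      then have "n choose l = 0" "n choose Suc l = 0" by simp_all
      moreover have "(Suc n choose l) = (n choose l')" using True Suc by simp
      ultimately show ?thesis
        using stay above below Suc by (simp add: sum_lattice_moves del: binomial_Suc_Suc)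
    next
      case False
      then obtain d where d: "n = l + d" using le_Suc_ex not_less by blast
      have "Suc l * (n choose Suc l) = d * (n choose l)"
        using binomial_absorb_comp[of n l] d by (metis add_diff_cancel_left' binomial_absorption)
      moreover have "n - Suc l = d - 1" "n - l' = Suc d" "n - l = d" using d Suc by simp_all
      ultimately have "(\<Sum>E\<in>covers_above D. walk_count n E)
          = f * (d * (n choose l)) * involution_number (d - 1)"
        using above by (metis mult.assoc mult.commute)
      with stay below have "walk_count (Suc n) D
        = f * ((n choose l) * involution_number d + d * (n choose l) * involution_number (d - 1)
           + (n choose l') * involution_number (Suc d))"
        unfolding walk_count.simps sum_lattice_moves \<open>n - l' = Suc d\<close> \<open>n - l = d\<close>
        by (simp only: distrib_left mult.assoc)
      also have "\<dots> = f * ((n choose l) + (n choose l')) * involution_number (Suc d)"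
        by (simp add: involution_number_Suc algebra_simps)
      finally show ?thesis using Suc d by simp
    qed
  qed
  then show ?case by (simp add: f_def l_def)
qed

lemma walk_count_eq_0: "young_diagram D \<Longrightarrow> n < card D \<Longrightarrow> walk_count n D = 0"
  by (simp add: walk_count_eq binomial_eq_0)

text \<open>The quotient \<open>q d = t (d + 1) / t d\<close> satisfies \<open>q (d + 1) = 1 + (d + 1) / q d\<close>, so a lower bound
  for \<open>q d\<close> turns into an upper bound for \<open>q (d + 1)\<close> and conversely. Hence the induction has
  to carry both bounds.\<close>
lemma involution_number_ratio:
  "sqrt (Suc d) * involution_number d \<le> involution_number (Suc d)
    \<and> involution_number (Suc d) \<le> (1 + sqrt (Suc d)) * involution_number d"
proof (induction d)
  case (Suc d)
  define x a b where "x = sqrt (Suc d)" and "a = real (involution_number (Suc d))"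
    and "b = real (involution_number d)"
  have x: "x > 0" "x\<^sup>2 = Suc d" and a: "a \<ge> 0" by (simp_all add: x_def a_def)
  have IH: "x * b \<le> a" "a \<le> (1 + x) * b" using Suc by (simp_all add: x_def a_def b_def)
  have next_eq: "real (involution_number (Suc (Suc d))) = a + x\<^sup>2 * b"
    by (simp add: a_def b_def x(2) algebra_simps)
  have "a + x\<^sup>2 * b \<le> (1 + x) * a"
    using mult_left_mono[OF IH(1), of x] x(1) by (simp add: power2_eq_square algebra_simps)
  moreover have "x \<le> sqrt (Suc (Suc d))" by (simp add: x_def)
  then have "(1 + x) * a \<le> (1 + sqrt (Suc (Suc d))) * a" using a by (intro mult_right_mono) auto
  ultimately have upper: "a + x\<^sup>2 * b \<le> (1 + sqrt (Suc (Suc d))) * a" by linarith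
  \<comment> \<open>Since \<open>b \<ge> a / (1 + x)\<close>, the lower bound amounts to \<open>\<surd>(x\<^sup>2 + 1) \<le> 1 + x\<^sup>2 / (1 + x)\<close>.\<close>
  have "sqrt (Suc (Suc d)) * (1 + x) \<le> 1 + x + x\<^sup>2"
  proof (rule power2_le_imp_le)
    have "(sqrt (Suc (Suc d)) * (1 + x))\<^sup>2 = (x\<^sup>2 + 1) * (1 + x)\<^sup>2"
      using x(2) by (simp add: power_mult_distrib)
    also have "\<dots> = (1 + x + x\<^sup>2)\<^sup>2 - x\<^sup>2" by (simp add: power2_eq_square algebra_simps)
    finally show "(sqrt (Suc (Suc d)) * (1 + x))\<^sup>2 \<le> (1 + x + x\<^sup>2)\<^sup>2" by simp
  qed (use x in simp)
  then have "sqrt (Suc (Suc d)) * (1 + x) * a \<le> (1 + x + x\<^sup>2) * a"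
    using a by (rule mult_right_mono)
  also have "\<dots> \<le> (1 + x) * (a + x\<^sup>2 * b)"
    using mult_left_mono[OF IH(2), of "x\<^sup>2"] by (simp add: algebra_simps)
  finally have "(1 + x) * (sqrt (Suc (Suc d)) * a) \<le> (1 + x) * (a + x\<^sup>2 * b)"
    by (simp only: ac_simps)
  then have "sqrt (Suc (Suc d)) * a \<le> a + x\<^sup>2 * b"
    using x by (simp only: mult_le_cancel_left_pos add_pos_pos zero_less_one)
  with upper show ?case
    unfolding next_eq by (simp only: a_def)
qed simp

text \<open>For \<open>|D| \<le> n\<close> and \<open>d = n - |D|\<close>, the closed formula gives
  \<open>W (n + 1) D / W n D = (n + 1) / (d + 1) * (t (d + 1) / t d) \<ge> (n + 1) / \<surd>(d + 1)\<close>, and \<open>d \<le> n\<close>. The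
  bound does not depend on \<open>D\<close>, which is what makes it usable under a sum over a whole level.\<close>
lemma walk_count_growth:
  assumes "young_diagram D"
  shows "sqrt (Suc n) * walk_count n D \<le> walk_count (Suc n) D"
proof (cases "card D \<le> n")
  case True
  define l where "l = card D"
  obtain d where d: "n = l + d" using True le_Suc_ex unfolding l_def by blast
  define t where "t = (\<lambda>k. real (involution_number k))"
  have t: "sqrt (Suc d) * t d \<le> t (Suc d)" and t0: "t d \<ge> 0"
    using involution_number_ratio[of d] by (simp_all add: t_def del: involution_number.simps)
  have binom: "real (Suc d) * (Suc n choose l) = Suc n * (n choose l)"
    using binomial_absorb_comp[of "Suc n" l] d
    by (metis Suc_diff_le add_diff_cancel_left' diff_Suc_1 le_add1 of_nat_mult)
  have "Suc d * sqrt (Suc n) \<le> Suc n * sqrt (Suc d)"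
  proof -
    have "sqrt (Suc d) \<le> sqrt (Suc n)" using d by simp
    then have "(sqrt (Suc d) * sqrt (Suc n)) * sqrt (Suc d) \<le> (sqrt (Suc d) * sqrt (Suc n)) * sqrt (Suc n)"
      by (intro mult_left_mono) auto
    moreover have "sqrt (Suc d) * sqrt (Suc d) = Suc d" "sqrt (Suc n) * sqrt (Suc n) = Suc n"
      by simp_all
    ultimately show ?thesis by (metis mult.assoc mult.commute)
  qed
  then have "(Suc d * sqrt (Suc n)) * ((n choose l) * t d) \<le> (Suc n * sqrt (Suc d)) * ((n choose l) * t d)"
    using t0 by (intro mult_right_mono) auto
  also have "\<dots> = real (Suc n * (n choose l)) * (sqrt (Suc d) * t d)" by (simp only: of_nat_mult ac_simps)
  also have "\<dots> \<le> real (Suc n * (n choose l)) * t (Suc d)"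
    using t by (intro mult_left_mono) auto
  also have "\<dots> = real (Suc d) * (Suc n choose l) * t (Suc d)"
    using binom by simp
  finally have "real (Suc d) * (sqrt (Suc n) * ((n choose l) * t d))
      \<le> real (Suc d) * ((Suc n choose l) * t (Suc d))"
    by (simp only: mult.assoc)
  then have main: "sqrt (Suc n) * ((n choose l) * t d) \<le> (Suc n choose l) * t (Suc d)"
    by (simp only: mult_le_cancel_left_pos of_nat_0_less_iff zero_less_Suc)
  have W: "real (walk_count n D) = tableau_count l D * ((n choose l) * t d)"
    "real (walk_count (Suc n) D) = tableau_count l D * ((Suc n choose l) * t (Suc d))"
    using walk_count_eq[OF assms, of n] walk_count_eq[OF assms, of "Suc n"] d
    by (simp_all add: t_def l_def[symmetric] del: walk_count.simps involution_number.simps binomial_Suc_Suc)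
  show ?thesis
    unfolding W using mult_left_mono[OF main, of "real (tableau_count l D)"]
    by (simp only: of_nat_0_le_iff ac_simps simp_thms)
next
  case False
  then have "walk_count n D = 0"
    using walk_count_eq_0[OF assms] by simp
  then show ?thesis by (simp del: walk_count.simps)
qed

lemma walk_count_mono:
  assumes "young_diagram D" "m \<le> n"
  shows "walk_count m D \<le> walk_count n D"
proof -
  have "walk_count k D \<le> walk_count (Suc k) D" for k
    by (simp add: sum_lattice_moves)
  then show ?thesis using assms(2) by (rule lift_Suc_mono_le)
qed

lemma walk_count_pos:
  assumes "young_diagram D" "card D \<le> n"
  shows "walk_count n D > 0"
  using assms by (simp add: walk_count_eq tableau_count_pos involution_number_pos)

section \<open>Central measures on graded graphs\<close>

lemma finite_finite_paths:
  assumes "\<And>k. finite (level \<Gamma> k)"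
  shows "finite (finite_paths \<Gamma> n \<gamma>)"
  by (rule finite_subset[of _ "PiE {0..n} (level \<Gamma>)"])
    (auto simp: finite_paths_def intro!: finite_PiE assms)

lemma dim_graph_0:
  assumes "base \<Gamma> \<in> level \<Gamma> 0"
  shows "dim_graph \<Gamma> 0 \<gamma> = of_bool (\<gamma> = base \<Gamma>)"
proof (cases "\<gamma> = base \<Gamma>")
  case True
  have "finite_paths \<Gamma> 0 \<gamma> = {\<lambda>k\<in>{0}. base \<Gamma>}"
    using assms True by (auto simp: finite_paths_def fun_eq_iff PiE_iff extensional_def)
  then show ?thesis using True by (simp add: dim_graph_def)
next
  case False
  then have "finite_paths \<Gamma> 0 \<gamma> = {}" by (auto simp: finite_paths_def)
  then show ?thesis using False by (simp add: dim_graph_def)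
qed

lemma finite_paths_extend:
  assumes "p \<in> finite_paths \<Gamma> n \<gamma>" "\<gamma>' \<in> level \<Gamma> (Suc n)" "nearrow \<Gamma> \<gamma> \<gamma>'"
  shows "p(Suc n := \<gamma>') \<in> finite_paths \<Gamma> (Suc n) \<gamma>'"
  using assms
  by (auto simp: finite_paths_def PiE_iff extensional_def less_Suc_eq le_Suc_eq)

lemma finite_paths_restrict:
  assumes "p \<in> finite_paths \<Gamma> (Suc n) \<gamma>'"
  shows "restrict p {0..n} \<in> finite_paths \<Gamma> n (p n)"
    and "p n \<in> level \<Gamma> n" "nearrow \<Gamma> (p n) \<gamma>'"
    and "(restrict p {0..n})(Suc n := \<gamma>') = p"
  using assms
  by (auto simp: finite_paths_def PiE_iff extensional_def fun_eq_iff le_Suc_eq)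

text \<open>A path to \<open>\<gamma>'\<close> is a path to a predecessor of \<open>\<gamma>'\<close> extended by one step.\<close>
lemma dim_graph_Suc:
  assumes fin: "\<And>k. finite (level \<Gamma> k)" and \<gamma>': "\<gamma>' \<in> level \<Gamma> (Suc n)"
  shows "dim_graph \<Gamma> (Suc n) \<gamma>' = (\<Sum>\<gamma> | \<gamma> \<in> level \<Gamma> n \<and> nearrow \<Gamma> \<gamma> \<gamma>'. dim_graph \<Gamma> n \<gamma>)"
proof -
  let ?S = "{\<gamma> \<in> level \<Gamma> n. nearrow \<Gamma> \<gamma> \<gamma>'}"
  have "bij_betw (\<lambda>p. restrict p {0..n}) (finite_paths \<Gamma> (Suc n) \<gamma>') (\<Union>\<gamma>\<in>?S. finite_paths \<Gamma> n \<gamma>)"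
  proof (rule bij_betw_byWitness[where f' = "\<lambda>p. p(Suc n := \<gamma>')"])
    show "\<forall>p\<in>finite_paths \<Gamma> (Suc n) \<gamma>'. (restrict p {0..n})(Suc n := \<gamma>') = p"
      by (intro ballI finite_paths_restrict(4))
    show "\<forall>p\<in>(\<Union>\<gamma>\<in>?S. finite_paths \<Gamma> n \<gamma>). restrict (p(Suc n := \<gamma>')) {0..n} = p"
      by (auto simp: finite_paths_def fun_eq_iff PiE_iff extensional_def)
    show "(\<lambda>p. restrict p {0..n}) ` finite_paths \<Gamma> (Suc n) \<gamma>' \<subseteq> (\<Union>\<gamma>\<in>?S. finite_paths \<Gamma> n \<gamma>)"
    proof (rule image_subsetI)
      fix p assume p: "p \<in> finite_paths \<Gamma> (Suc n) \<gamma>'"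
      show "restrict p {0..n} \<in> (\<Union>\<gamma>\<in>?S. finite_paths \<Gamma> n \<gamma>)"
        using finite_paths_restrict(1-3)[OF p] by (intro UN_I[of "p n"]) simp_all
    qed
    show "(\<lambda>p. p(Suc n := \<gamma>')) ` (\<Union>\<gamma>\<in>?S. finite_paths \<Gamma> n \<gamma>) \<subseteq> finite_paths \<Gamma> (Suc n) \<gamma>'"
      by (rule image_subsetI) (use finite_paths_extend[OF _ \<gamma>'] in auto)
  qed
  then have "dim_graph \<Gamma> (Suc n) \<gamma>' = card (\<Union>\<gamma>\<in>?S. finite_paths \<Gamma> n \<gamma>)"
    unfolding dim_graph_def by (rule bij_betw_same_card)
  also have "\<dots> = (\<Sum>\<gamma>\<in>?S. dim_graph \<Gamma> n \<gamma>)"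
    unfolding dim_graph_def
  proof (rule card_UN_disjoint)
    show "finite ?S" using fin by simp
    show "\<forall>\<gamma>\<in>?S. finite (finite_paths \<Gamma> n \<gamma>)" using finite_finite_paths[of \<Gamma>] fin by blast
    show "\<forall>\<gamma>\<in>?S. \<forall>\<delta>\<in>?S. \<gamma> \<noteq> \<delta> \<longrightarrow> finite_paths \<Gamma> n \<gamma> \<inter> finite_paths \<Gamma> n \<delta> = {}"
      by (auto simp: finite_paths_def)
  qed
  finally show ?thesis .
qed

lemma space_path_space: "space (path_space \<Gamma>) = infinite_paths \<Gamma>"
  by (auto simp: path_space_def space_restrict_space space_PiM infinite_paths_def)

lemma measurable_coordinate:
  "(\<lambda>\<omega>. \<omega> n) \<in> measurable (path_space \<Gamma>) (count_space (level \<Gamma> n))"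
  unfolding path_space_def by (intro measurable_restrict_space1 measurable_component_singleton) simp

lemma central_measure_space:
  assumes "central_measure \<Gamma> P"
  shows "prob_space P" "sets P = sets (path_space \<Gamma>)" "space P = infinite_paths \<Gamma>"
  using assms sets_eq_imp_space_eq[of P "path_space \<Gamma>"]
  by (auto simp: central_measure_def space_path_space)

lemma sets_coordinate_eq:
  assumes "sets P = sets (path_space \<Gamma>)"
  shows "{\<omega> \<in> space P. \<omega> n = x} \<in> sets P"
proof (cases "x \<in> level \<Gamma> n")
  case True
  then have "(\<lambda>\<omega>. \<omega> n) -` {x} \<inter> space P \<in> sets P"
    using measurable_sets[OF measurable_coordinate, of "{x}" \<Gamma> n] assms sets_eq_imp_space_eq[OF assms]
    by simp
  moreover have "(\<lambda>\<omega>. \<omega> n) -` {x} \<inter> space P = {\<omega> \<in> space P. \<omega> n = x}" by auto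
  ultimately show ?thesis by simp
next
  case False
  then have "{\<omega> \<in> space P. \<omega> n = x} = {}"
    using sets_eq_imp_space_eq[OF assms] by (auto simp: space_path_space infinite_paths_def)
  then show ?thesis by (metis sets.empty_sets)
qed

text \<open>For a central measure this is the common probability of all cylinders given by a path from the
  root to \<open>\<gamma>\<close>.\<close>
definition path_weight :: "'v graded_graph \<Rightarrow> (nat \<Rightarrow> 'v) measure \<Rightarrow> nat \<Rightarrow> 'v \<Rightarrow> real" where
  "path_weight \<Gamma> P n \<gamma> = measure P {\<omega> \<in> space P. \<omega> n = \<gamma>} / real (dim_graph \<Gamma> n \<gamma>)"

lemma path_weight_nonneg: "path_weight \<Gamma> P n \<gamma> \<ge> 0"
  by (simp add: path_weight_def)

lemma measure_cylinder:
  assumes "central_measure \<Gamma> P" "\<gamma> \<in> level \<Gamma> n" "p \<in> finite_paths \<Gamma> n \<gamma>"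
  shows "measure P {\<omega> \<in> space P. \<forall>k\<in>{1..n}. \<omega> k = p k} = path_weight \<Gamma> P n \<gamma>"
  using assms unfolding central_measure_def path_weight_def by blast

text \<open>The cylinder of a path to \<open>\<gamma>\<close> is the disjoint union of the cylinders of its one-step extensions.
  The assumption on the dimension provides a path to start from.\<close>
lemma path_weight_harmonic:
  assumes P: "central_measure \<Gamma> P" and fin: "\<And>k. finite (level \<Gamma> k)"
    and \<gamma>: "\<gamma> \<in> level \<Gamma> n" and pos: "dim_graph \<Gamma> n \<gamma> > 0"
  shows "path_weight \<Gamma> P n \<gamma>
    = (\<Sum>\<gamma>' | \<gamma>' \<in> level \<Gamma> (Suc n) \<and> nearrow \<Gamma> \<gamma> \<gamma>'. path_weight \<Gamma> P (Suc n) \<gamma>')"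
proof -
  interpret prob_space P using central_measure_space(1)[OF P] .
  let ?S = "{\<gamma>' \<in> level \<Gamma> (Suc n). nearrow \<Gamma> \<gamma> \<gamma>'}"
  obtain p where p: "p \<in> finite_paths \<Gamma> n \<gamma>"
    using pos unfolding dim_graph_def by (metis card.empty equals0I less_irrefl)
  define C where "C = (\<lambda>m q. {\<omega> \<in> space P. \<forall>k\<in>{1..m}. \<omega> k = q k})"
  have C_sets: "C m q \<in> events" for m q
  proof -
    have "C m q = space P \<inter> (\<Inter>k\<in>{1..m}. {\<omega> \<in> space P. \<omega> k = q k})"
      by (auto simp: C_def)
    also have "\<dots> \<in> events"
      using sets_coordinate_eq[OF central_measure_space(2)[OF P]]
      by (cases "{1..m} = {}") (auto intro!: sets.Int sets.finite_INT)
    finally show ?thesis .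
  qed
  have "\<omega> n = \<gamma>" if "\<omega> \<in> C n p" for \<omega>
    using that p by (cases n) (auto simp: C_def central_measure_space(3)[OF P] infinite_paths_def finite_paths_def)
  then have "C n p = (\<Union>\<gamma>'\<in>?S. C (Suc n) (p(Suc n := \<gamma>')))"
    by (force simp: C_def central_measure_space(3)[OF P] infinite_paths_def PiE_iff)
  moreover have "disjoint_family_on (\<lambda>\<gamma>'. C (Suc n) (p(Suc n := \<gamma>'))) ?S"
    unfolding disjoint_family_on_def C_def
    by (intro ballI impI equals0I) (auto dest!: bspec[of _ _ "Suc n"])
  ultimately have "prob (C n p) = (\<Sum>\<gamma>'\<in>?S. prob (C (Suc n) (p(Suc n := \<gamma>'))))"
    using finite_measure_finite_Union[of ?S "\<lambda>\<gamma>'. C (Suc n) (p(Suc n := \<gamma>'))"] C_sets fin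
    by auto
  moreover have "prob (C n p) = path_weight \<Gamma> P n \<gamma>"
    unfolding C_def by (rule measure_cylinder[OF P \<gamma> p])
  moreover have "prob (C (Suc n) (p(Suc n := \<gamma>'))) = path_weight \<Gamma> P (Suc n) \<gamma>'" if "\<gamma>' \<in> ?S" for \<gamma>'
    unfolding C_def by (rule measure_cylinder[OF P _ finite_paths_extend[OF p]]) (use that in auto)
  ultimately show ?thesis by simp
qed

section \<open>The rook-Brauer graph\<close>

lemma mem_level_rook_brauer:
  "\<gamma> \<in> level rook_brauer_graph n \<longleftrightarrow> fst \<gamma> = n \<and> young_diagram (snd \<gamma>) \<and> card (snd \<gamma>) \<le> n"
  by (cases \<gamma>) (auto simp: rook_brauer_graph_def young_diagrams_def)

lemma finite_level_rook_brauer: "finite (level rook_brauer_graph n)"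
  by (simp add: rook_brauer_graph_def finite_young_diagrams)

lemma base_rook_brauer: "base rook_brauer_graph = (0, {})"
  by (simp add: rook_brauer_graph_def)

lemma nearrow_rook_brauer_iff:
  assumes "\<gamma> \<in> level rook_brauer_graph n" "\<gamma>' \<in> level rook_brauer_graph (Suc n)"
  shows "nearrow rook_brauer_graph \<gamma> \<gamma>' \<longleftrightarrow> snd \<gamma> \<in> lattice_moves (snd \<gamma>')"
proof -
  have "nearrow rook_brauer_graph \<gamma> \<gamma>' \<longleftrightarrow> edge rook_brauer_graph \<gamma> \<gamma>'"
    using assms by (auto simp: nearrow_def)
  also have "\<dots> \<longleftrightarrow> snd \<gamma> \<in> lattice_moves (snd \<gamma>')"
    using assms unfolding mem_level_rook_brauer
    by (cases \<gamma>; cases \<gamma>')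
      (auto simp: rook_brauer_graph_def lattice_moves_def covers_above_def covers_below_def)
  finally show ?thesis .
qed

text \<open>The condition \<open>card E \<le> n\<close> appears because a diagram with \<open>n + 1\<close> or \<open>n + 2\<close> boxes can be a
  neighbour of \<open>snd \<gamma>'\<close> without occurring on level \<open>n\<close>.\<close>
lemma sum_predecessors_rook_brauer:
  assumes "\<gamma>' \<in> level rook_brauer_graph (Suc n)"
  shows "(\<Sum>\<gamma> | \<gamma> \<in> level rook_brauer_graph n \<and> nearrow rook_brauer_graph \<gamma> \<gamma>'. h (snd \<gamma>))
    = (\<Sum>E | E \<in> lattice_moves (snd \<gamma>') \<and> card E \<le> n. h E)"
proof -
  have young: "young_diagram (snd \<gamma>')" using assms by (simp add: mem_level_rook_brauer)
  show ?thesis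
  proof (rule sum.reindex_bij_witness[where i = "Pair n" and j = snd])
    fix \<gamma> assume "\<gamma> \<in> {\<gamma> \<in> level rook_brauer_graph n. nearrow rook_brauer_graph \<gamma> \<gamma>'}"
    then show "(n, snd \<gamma>) = \<gamma>" "snd \<gamma> \<in> {E \<in> lattice_moves (snd \<gamma>'). card E \<le> n}"
      using nearrow_rook_brauer_iff[OF _ assms, of \<gamma>] by (auto simp: mem_level_rook_brauer)
  next
    fix E assume E: "E \<in> {E \<in> lattice_moves (snd \<gamma>'). card E \<le> n}"
    then have "(n, E) \<in> level rook_brauer_graph n"
      using young_diagram_lattice_moves[OF young] by (auto simp: mem_level_rook_brauer)
    with E show "(n, E) \<in> {\<gamma> \<in> level rook_brauer_graph n. nearrow rook_brauer_graph \<gamma> \<gamma>'}"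
      using nearrow_rook_brauer_iff[OF _ assms, of "(n, E)"] by auto
  qed simp_all
qed

lemma dim_rook_brauer_graph:
  "\<gamma> \<in> level rook_brauer_graph n \<Longrightarrow> dim_graph rook_brauer_graph n \<gamma> = walk_count n (snd \<gamma>)"
proof (induction n arbitrary: \<gamma>)
  case 0
  have "(0, {}) \<in> level rook_brauer_graph 0" by (simp add: mem_level_rook_brauer)
  with 0 show ?case
    by (cases \<gamma>) (auto simp: dim_graph_0 base_rook_brauer mem_level_rook_brauer)
next
  case (Suc n)
  have young: "young_diagram (snd \<gamma>)" using Suc.prems by (simp add: mem_level_rook_brauer)
  have "dim_graph rook_brauer_graph (Suc n) \<gamma> = (\<Sum>\<delta> | \<delta> \<in> level rook_brauer_graph n
      \<and> nearrow rook_brauer_graph \<delta> \<gamma>. walk_count n (snd \<delta>))"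
    by (subst dim_graph_Suc[OF finite_level_rook_brauer Suc.prems]) (simp add: Suc.IH)
  also have "\<dots> = (\<Sum>E | E \<in> lattice_moves (snd \<gamma>) \<and> card E \<le> n. walk_count n E)"
    by (rule sum_predecessors_rook_brauer[OF Suc.prems])
  also have "\<dots> = (\<Sum>E\<in>lattice_moves (snd \<gamma>). walk_count n E)"
    using walk_count_eq_0 young_diagram_lattice_moves[OF young]
    by (intro sum.mono_neutral_left) (auto simp: finite_lattice_moves not_le)
  finally show ?case by simp
qed

lemma dim_rook_brauer_graph_pos:
  "\<gamma> \<in> level rook_brauer_graph n \<Longrightarrow> dim_graph rook_brauer_graph n \<gamma> > 0"
  by (subst dim_rook_brauer_graph) (auto simp: mem_level_rook_brauer intro: walk_count_pos)

text \<open>The walk counts start from \<open>card (snd \<gamma>)\<close> rather than \<open>m\<close>: at \<open>j = 0\<close> the vertex \<open>\<gamma>\<close> alone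
  already gives the bound, since \<open>snd \<gamma>\<close> can be reached in \<open>card (snd \<gamma>)\<close> steps. Passing from
  \<open>j\<close> to \<open>j + 1\<close>, harmonicity moves the weights up one level, and exchanging the summations applies the
  recursion of \<open>walk_count\<close>.\<close>
lemma path_weight_le_walks:
  assumes P: "central_measure rook_brauer_graph P" and \<gamma>: "\<gamma> \<in> level rook_brauer_graph m"
  shows "path_weight rook_brauer_graph P m \<gamma> \<le> (\<Sum>\<delta>\<in>level rook_brauer_graph (m + j).
    path_weight rook_brauer_graph P (m + j) \<delta> * walk_count (card (snd \<gamma>) + j) (snd \<delta>))"
proof (induction j)
  case 0
  let ?h = "\<lambda>\<delta>. path_weight rook_brauer_graph P m \<delta> * walk_count (card (snd \<gamma>)) (snd \<delta>)"
  have "path_weight rook_brauer_graph P m \<gamma> * 1 \<le> ?h \<gamma>"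
    using walk_count_pos[of "snd \<gamma>" "card (snd \<gamma>)"] \<gamma>
    by (intro mult_left_mono path_weight_nonneg) (auto simp: mem_level_rook_brauer Suc_le_eq)
  also have "\<dots> \<le> sum ?h (level rook_brauer_graph m)"
    by (rule member_le_sum[OF \<gamma>]) (auto simp: path_weight_nonneg finite_level_rook_brauer)
  finally show ?case by simp
next
  case (Suc j)
  let ?L = "level rook_brauer_graph" and ?k = "card (snd \<gamma>) + j" and ?n = "m + j"
  let ?w = "path_weight rook_brauer_graph P" and ?near = "nearrow rook_brauer_graph"
  have "(\<Sum>\<delta>\<in>?L ?n. ?w ?n \<delta> * walk_count ?k (snd \<delta>))
      = (\<Sum>\<delta>\<in>?L ?n. \<Sum>\<epsilon> | \<epsilon> \<in> ?L (Suc ?n) \<and> ?near \<delta> \<epsilon>. ?w (Suc ?n) \<epsilon> * walk_count ?k (snd \<delta>))"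
    by (intro sum.cong refl, subst path_weight_harmonic[OF P finite_level_rook_brauer])
      (auto simp: dim_rook_brauer_graph_pos sum_distrib_right)
  also have "\<dots> = (\<Sum>\<epsilon>\<in>?L (Suc ?n). \<Sum>\<delta> | \<delta> \<in> ?L ?n \<and> ?near \<delta> \<epsilon>. ?w (Suc ?n) \<epsilon> * walk_count ?k (snd \<delta>))"
    by (intro sum.swap_restrict finite_level_rook_brauer)
  also have "\<dots> = (\<Sum>\<epsilon>\<in>?L (Suc ?n). ?w (Suc ?n) \<epsilon>
      * (\<Sum>\<delta> | \<delta> \<in> ?L ?n \<and> ?near \<delta> \<epsilon>. real (walk_count ?k (snd \<delta>))))"
    by (simp only: sum_distrib_left)
  also have "\<dots> \<le> (\<Sum>\<epsilon>\<in>?L (Suc ?n). ?w (Suc ?n) \<epsilon> * walk_count (Suc ?k) (snd \<epsilon>))"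
  proof (intro sum_mono mult_left_mono path_weight_nonneg)
    fix \<epsilon> assume "\<epsilon> \<in> ?L (Suc ?n)"
    then have "(\<Sum>\<delta> | \<delta> \<in> ?L ?n \<and> ?near \<delta> \<epsilon>. real (walk_count ?k (snd \<delta>)))
        = (\<Sum>E | E \<in> lattice_moves (snd \<epsilon>) \<and> card E \<le> ?n. real (walk_count ?k E))"
      by (rule sum_predecessors_rook_brauer)
    also have "\<dots> \<le> (\<Sum>E\<in>lattice_moves (snd \<epsilon>). real (walk_count ?k E))"
      by (intro sum_mono2) (auto simp: finite_lattice_moves)
    finally show "(\<Sum>\<delta> | \<delta> \<in> ?L ?n \<and> ?near \<delta> \<epsilon>. real (walk_count ?k (snd \<delta>)))
        \<le> real (walk_count (Suc ?k) (snd \<epsilon>))" by simp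
  qed
  finally show ?case using Suc.IH by simp
qed

lemma path_weight_mult_walk_count:
  assumes "\<gamma> \<in> level rook_brauer_graph n"
  shows "path_weight rook_brauer_graph P n \<gamma> * walk_count n (snd \<gamma>)
    = measure P {\<omega> \<in> space P. \<omega> n = \<gamma>}"
  using dim_rook_brauer_graph_pos[OF assms] dim_rook_brauer_graph[OF assms]
  by (simp add: path_weight_def)

lemma sum_vertex_prob_le_1:
  assumes "central_measure \<Gamma> P" "finite (level \<Gamma> n)"
  shows "(\<Sum>\<gamma>\<in>level \<Gamma> n. measure P {\<omega> \<in> space P. \<omega> n = \<gamma>}) \<le> 1"
proof -
  interpret prob_space P using central_measure_space(1)[OF assms(1)] .
  have "(\<Sum>\<gamma>\<in>level \<Gamma> n. prob {\<omega> \<in> space P. \<omega> n = \<gamma>})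
      = prob (\<Union>\<gamma>\<in>level \<Gamma> n. {\<omega> \<in> space P. \<omega> n = \<gamma>})"
    using sets_coordinate_eq[OF central_measure_space(2)[OF assms(1)]]
    by (intro finite_measure_finite_Union[symmetric] assms(2)) (auto simp: disjoint_family_on_def)
  then show ?thesis by simp
qed

text \<open>By the previous estimates the weight is at most \<open>1 / \<surd>(n + 1)\<close> for every \<open>n \<ge> m\<close>: the deficit
  \<open>card (snd \<gamma>) < m\<close> shortens the walks to level \<open>n + 1\<close> by at least one step, and the first step saved
  already costs a factor \<open>\<surd>(n + 1)\<close>.\<close>
lemma path_weight_eq_0:
  assumes P: "central_measure rook_brauer_graph P"
    and \<gamma>: "\<gamma> \<in> level rook_brauer_graph m" and less: "card (snd \<gamma>) < m"
  shows "path_weight rook_brauer_graph P m \<gamma> = 0"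
proof (rule ccontr)
  let ?w = "path_weight rook_brauer_graph P" and ?L = "level rook_brauer_graph"
  assume "?w m \<gamma> \<noteq> 0"
  then have pos: "?w m \<gamma> > 0" using path_weight_nonneg[of rook_brauer_graph P m \<gamma>] by simp
  have bound: "sqrt (Suc n) * ?w m \<gamma> \<le> 1" if n: "m \<le> n" for n
  proof -
    have step: "sqrt (Suc n) * (?w (Suc n) \<delta> * walk_count (card (snd \<gamma>) + (Suc n - m)) (snd \<delta>))
        \<le> measure P {\<omega> \<in> space P. \<omega> (Suc n) = \<delta>}" if \<delta>: "\<delta> \<in> ?L (Suc n)" for \<delta>
    proof -
      have young: "young_diagram (snd \<delta>)" using \<delta> by (simp add: mem_level_rook_brauer)
      have "walk_count (card (snd \<gamma>) + (Suc n - m)) (snd \<delta>) \<le> walk_count n (snd \<delta>)"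
        using less n by (intro walk_count_mono[OF young]) simp
      then have "sqrt (Suc n) * walk_count (card (snd \<gamma>) + (Suc n - m)) (snd \<delta>)
          \<le> sqrt (Suc n) * walk_count n (snd \<delta>)"
        by (intro mult_left_mono) simp_all
      also have "\<dots> \<le> walk_count (Suc n) (snd \<delta>)" by (rule walk_count_growth[OF young])
      finally have "?w (Suc n) \<delta> * (sqrt (Suc n) * walk_count (card (snd \<gamma>) + (Suc n - m)) (snd \<delta>))
          \<le> ?w (Suc n) \<delta> * walk_count (Suc n) (snd \<delta>)"
        by (rule mult_left_mono[OF _ path_weight_nonneg])
      then show ?thesis
        unfolding path_weight_mult_walk_count[OF \<delta>] by (simp only: ac_simps)
    qed
    have "sqrt (Suc n) * ?w m \<gamma> \<le> sqrt (Suc n) * (\<Sum>\<delta>\<in>?L (Suc n).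
        ?w (Suc n) \<delta> * walk_count (card (snd \<gamma>) + (Suc n - m)) (snd \<delta>))"
      using path_weight_le_walks[OF P \<gamma>, of "Suc n - m"] n by (intro mult_left_mono) auto
    also have "\<dots> \<le> (\<Sum>\<delta>\<in>?L (Suc n). measure P {\<omega> \<in> space P. \<omega> (Suc n) = \<delta>})"
      unfolding sum_distrib_left by (rule sum_mono[OF step])
    also have "\<dots> \<le> 1"
      by (rule sum_vertex_prob_le_1[OF P finite_level_rook_brauer])
    finally show ?thesis .
  qed
  obtain N :: nat where N: "1 / (?w m \<gamma>)\<^sup>2 < N" using reals_Archimedean2 by blast
  have "(sqrt (Suc (m + N)) * ?w m \<gamma>)\<^sup>2 \<le> 1"
    using bound[of "m + N"] pos by (intro power_le_one) auto
  then have "real (Suc (m + N)) * (?w m \<gamma>)\<^sup>2 \<le> 1"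
    by (simp add: power_mult_distrib)
  moreover have "1 < N * (?w m \<gamma>)\<^sup>2" using N pos by (simp add: field_simps)
  moreover have "N * (?w m \<gamma>)\<^sup>2 \<le> real (Suc (m + N)) * (?w m \<gamma>)\<^sup>2"
    by (intro mult_right_mono) auto
  ultimately show False by linarith
qed

section \<open>Forward paths\<close>

lemma infinite_paths_rook_brauerD:
  assumes "\<omega> \<in> infinite_paths rook_brauer_graph"
  shows "\<omega> 0 = (0, {})" "\<omega> n \<in> level rook_brauer_graph n"
    "snd (\<omega> n) \<in> lattice_moves (snd (\<omega> (Suc n)))"
proof -
  have level: "\<omega> n \<in> level rook_brauer_graph n" for n
    using assms by (auto simp: infinite_paths_def)
  then show "\<omega> n \<in> level rook_brauer_graph n" .
  show "\<omega> 0 = (0, {})" using assms by (simp add: infinite_paths_def base_rook_brauer)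
  show "snd (\<omega> n) \<in> lattice_moves (snd (\<omega> (Suc n)))"
    using assms nearrow_rook_brauer_iff[OF level level] by (auto simp: infinite_paths_def)
qed

lemma card_add_box_sequence:
  assumes "\<mu> 0 = {}" "\<And>n. add_box (\<mu> n) (\<mu> (Suc n))"
  shows "card (\<mu> n) = n"
  by (induction n) (simp_all add: assms(1) card_add_box[OF assms(2)])

text \<open>A path starts at size \<open>0\<close> and changes its size by at most one in each step, so it has the maximal
  size \<open>n\<close> at all levels iff every step adds a box.\<close>
lemma forward_paths_eq_card:
  "forward_paths = {\<omega> \<in> infinite_paths rook_brauer_graph. \<forall>n. card (snd (\<omega> n)) = n}"
proof -
  have "(\<forall>n. add_box (snd (\<omega> n)) (snd (\<omega> (Suc n)))) \<longleftrightarrow> (\<forall>n. card (snd (\<omega> n)) = n)"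
    if \<omega>: "\<omega> \<in> infinite_paths rook_brauer_graph" for \<omega>
  proof
    assume fwd: "\<forall>n. add_box (snd (\<omega> n)) (snd (\<omega> (Suc n)))"
    show "\<forall>n. card (snd (\<omega> n)) = n"
      using card_add_box_sequence[of "\<lambda>n. snd (\<omega> n)"] infinite_paths_rook_brauerD(1)[OF \<omega>] fwd
      by simp
  next
    assume card: "\<forall>n. card (snd (\<omega> n)) = n"
    show "\<forall>n. add_box (snd (\<omega> n)) (snd (\<omega> (Suc n)))"
    proof
      fix n
      have "card (snd (\<omega> (Suc n))) = Suc (card (snd (\<omega> n)))" using card by simp
      then show "add_box (snd (\<omega> n)) (snd (\<omega> (Suc n)))"
        using infinite_paths_rook_brauerD(3)[OF \<omega>, of n]
          card_add_box[of "snd (\<omega> (Suc n))" "snd (\<omega> n)"]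
        by (auto simp: lattice_moves_def covers_above_def covers_below_def)
    qed
  qed
  then show ?thesis by (auto simp: forward_paths_def)
qed

lemma forward_paths_measurable: "forward_paths \<in> sets (path_space rook_brauer_graph)"
proof -
  let ?M = "path_space rook_brauer_graph"
  have "(\<lambda>\<omega>. \<omega> n) -` {\<gamma> \<in> level rook_brauer_graph n. card (snd \<gamma>) = n} \<inter> space ?M \<in> sets ?M" for n
    by (rule measurable_sets[OF measurable_coordinate]) simp
  then have "(\<Inter>n. (\<lambda>\<omega>. \<omega> n) -` {\<gamma> \<in> level rook_brauer_graph n. card (snd \<gamma>) = n} \<inter> space ?M) \<in> sets ?M"
    by (intro sets.countable_INT) auto
  also have "(\<Inter>n. (\<lambda>\<omega>. \<omega> n) -` {\<gamma> \<in> level rook_brauer_graph n. card (snd \<gamma>) = n} \<inter> space ?M) = forward_paths"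
    using infinite_paths_rook_brauerD(2) by (auto simp: forward_paths_eq_card space_path_space)
  finally show ?thesis .
qed

lemma infinite_paths_young_iff:
  "\<omega> \<in> infinite_paths young_graph \<longleftrightarrow> \<omega> 0 = {} \<and> (\<forall>n. add_box (\<omega> n) (\<omega> (Suc n)))"
proof
  assume "\<omega> \<in> infinite_paths young_graph"
  then show "\<omega> 0 = {} \<and> (\<forall>n. add_box (\<omega> n) (\<omega> (Suc n)))"
    by (auto simp: infinite_paths_def young_graph_def nearrow_def)
next
  assume \<omega>: "\<omega> 0 = {} \<and> (\<forall>n. add_box (\<omega> n) (\<omega> (Suc n)))"
  have "card (\<omega> n) = n" for n
    using \<omega> by (intro card_add_box_sequence) auto
  then have "\<omega> n \<in> young_diagrams n" for n
    using \<omega> by (auto simp: young_diagrams_def add_box_def)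
  then show "\<omega> \<in> infinite_paths young_graph"
    using \<omega> by (auto simp: infinite_paths_def young_graph_def nearrow_def)
qed

lemma young_embedding_forward:
  assumes "\<omega> \<in> infinite_paths young_graph"
  shows "young_embedding \<omega> \<in> forward_paths"
proof -
  have \<omega>: "\<omega> 0 = {}" "\<And>n. add_box (\<omega> n) (\<omega> (Suc n))"
    using assms by (auto simp: infinite_paths_young_iff)
  have card: "card (\<omega> n) = n" for n
    using \<omega> by (intro card_add_box_sequence) auto
  have level: "(n, \<omega> n) \<in> level rook_brauer_graph n" for n
    using \<omega>(2)[of n] card by (simp add: mem_level_rook_brauer add_box_def)
  have "nearrow rook_brauer_graph (n, \<omega> n) (Suc n, \<omega> (Suc n))" for n
    using nearrow_rook_brauer_iff[OF level level] \<omega>(2)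
    by (simp add: lattice_moves_def covers_below_def)
  then show ?thesis
    using \<omega> level
    by (auto simp: forward_paths_def infinite_paths_def young_embedding_def base_rook_brauer)
qed

lemma forward_projection_young:
  assumes "\<omega> \<in> forward_paths"
  shows "(\<lambda>n. snd (\<omega> n)) \<in> infinite_paths young_graph"
  using assms infinite_paths_rook_brauerD(1)[of \<omega>]
  by (simp add: infinite_paths_young_iff forward_paths_def)

lemma young_embedding_projection:
  assumes "\<omega> \<in> forward_paths"
  shows "young_embedding (\<lambda>n. snd (\<omega> n)) = \<omega>"
proof
  fix n
  have "\<omega> n \<in> level rook_brauer_graph n"
    using assms infinite_paths_rook_brauerD(2) by (auto simp: forward_paths_def)
  then show "young_embedding (\<lambda>n. snd (\<omega> n)) n = \<omega> n"
    by (cases "\<omega> n") (simp add: young_embedding_def mem_level_rook_brauer)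
qed

lemma bij_betw_young_embedding:
  "bij_betw young_embedding (infinite_paths young_graph) forward_paths"
  by (rule bij_betw_byWitness[where f' = "\<lambda>\<omega> n. snd (\<omega> n)"])
    (auto simp: young_embedding_forward forward_projection_young young_embedding_projection,
      simp add: young_embedding_def)

lemma measurable_into_path_space:
  assumes "f \<in> space M \<rightarrow> infinite_paths \<Gamma>"
    and "\<And>n. (\<lambda>x. f x n) \<in> measurable M (count_space (level \<Gamma> n))"
  shows "f \<in> measurable M (path_space \<Gamma>)"
  unfolding path_space_def
proof (rule measurable_restrict_space2[OF assms(1)])
  have "(\<lambda>x. \<lambda>n\<in>UNIV. f x n) \<in> measurable M (PiM UNIV (\<lambda>n. count_space (level \<Gamma> n)))"
    by (intro measurable_restrict assms(2))
  then show "f \<in> measurable M (PiM UNIV (\<lambda>n. count_space (level \<Gamma> n)))"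
    by (simp only: restrict_UNIV)
qed

lemma sets_image_eq_of_measurable_bij:
  assumes e: "e \<in> measurable M N" and g: "g \<in> measurable N M"
    and ge: "\<And>x. x \<in> space M \<Longrightarrow> g (e x) = x" and eg: "\<And>y. y \<in> space N \<Longrightarrow> e (g y) = y"
  shows "sets N = (`) e ` sets M"
proof (intro equalityI subsetI)
  fix S assume S: "S \<in> sets N"
  have "S = e ` (e -` S \<inter> space M)"
    using sets.sets_into_space[OF S] eg measurable_space[OF g] by force
  then show "S \<in> (`) e ` sets M" using measurable_sets[OF e S] by blast
next
  fix S assume "S \<in> (`) e ` sets M"
  then obtain T where T: "T \<in> sets M" "S = e ` T" by blast
  have "S = g -` T \<inter> space N"
  proof (intro equalityI subsetI)
    fix y assume "y \<in> S"
    then obtain x where x: "x \<in> T" "y = e x" using T(2) by blast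
    moreover have "x \<in> space M" using sets.sets_into_space[OF T(1)] x(1) by blast
    ultimately show "y \<in> g -` T \<inter> space N" using ge measurable_space[OF e] by simp
  next
    fix y assume "y \<in> g -` T \<inter> space N"
    then have "e (g y) = y" "g y \<in> T" using eg by simp_all
    then show "y \<in> S" unfolding T(2) by (metis imageI)
  qed
  then show "S \<in> sets N" using measurable_sets[OF g T(1)] by simp
qed

text \<open>The embedding and its inverse, the projection to the diagrams, are both measurable because each
  of their coordinates depends on a single coordinate.\<close>
lemma sets_forward_paths:
  "sets (restrict_space (path_space rook_brauer_graph) forward_paths)
    = (`) young_embedding ` sets (path_space young_graph)"
proof (rule sets_image_eq_of_measurable_bij[where g = "\<lambda>\<omega> n. snd (\<omega> n)"])
  let ?N = "restrict_space (path_space rook_brauer_graph) forward_paths"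
  have sub: "forward_paths \<subseteq> infinite_paths rook_brauer_graph" by (auto simp: forward_paths_def)
  then have space_N: "space ?N = forward_paths"
    by (auto simp: space_restrict_space space_path_space)
  show "young_embedding \<in> measurable (path_space young_graph) ?N"
  proof (intro measurable_restrict_space2 measurable_into_path_space)
    show "young_embedding \<in> space (path_space young_graph) \<rightarrow> forward_paths"
      "young_embedding \<in> space (path_space young_graph) \<rightarrow> infinite_paths rook_brauer_graph"
      using young_embedding_forward sub by (auto simp: space_path_space)
    fix n
    have "Pair n \<in> measurable (count_space (level young_graph n)) (count_space (level rook_brauer_graph n))"
      by (auto simp: mem_level_rook_brauer young_graph_def young_diagrams_def)
    then show "(\<lambda>\<omega>. young_embedding \<omega> n) \<in> measurable (path_space young_graph)
        (count_space (level rook_brauer_graph n))"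
      unfolding young_embedding_def by (rule measurable_compose[OF measurable_coordinate])
  qed
  show "(\<lambda>\<omega> n. snd (\<omega> n)) \<in> measurable ?N (path_space young_graph)"
  proof (rule measurable_into_path_space)
    show "(\<lambda>\<omega> n. snd (\<omega> n)) \<in> space ?N \<rightarrow> infinite_paths young_graph"
      using forward_projection_young space_N by auto
    fix n
    have "(\<lambda>\<omega>. \<omega> n) \<in> measurable ?N (count_space (level rook_brauer_graph n))"
      by (rule measurable_restrict_space1[OF measurable_coordinate])
    then have "(\<lambda>\<omega>. snd (\<omega> n)) \<in> measurable ?N (count_space UNIV)"
      by (rule measurable_compose) simp
    moreover have "snd (\<omega> n) \<in> level young_graph n" if "\<omega> \<in> space ?N" for \<omega>
      using forward_projection_young[of \<omega>] that space_N by (auto simp: infinite_paths_def)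
    ultimately have "(\<lambda>\<omega>. snd (\<omega> n)) \<in> measurable ?N (restrict_space (count_space UNIV) (level young_graph n))"
      by (intro measurable_restrict_space2) auto
    then show "(\<lambda>\<omega>. snd (\<omega> n)) \<in> measurable ?N (count_space (level young_graph n))"
      by (simp add: restrict_count_space)
  qed
  show "(\<lambda>n. snd (young_embedding \<omega> n)) = \<omega>" for \<omega>
    by (simp add: young_embedding_def)
  show "young_embedding (\<lambda>n. snd (\<omega> n)) = \<omega>" if "\<omega> \<in> space ?N" for \<omega>
    using young_embedding_projection that space_N by simp
qed

text \<open>A path that is not a forward path meets a vertex \<open>(n, \<lambda>)\<close> with \<open>|\<lambda>| < n\<close>; these vertices are
  countably many and each is met with probability \<open>0\<close>.\<close>
lemma central_measure_forward_paths:
  assumes P: "central_measure rook_brauer_graph P"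
  shows "measure P forward_paths = 1"
proof -
  interpret prob_space P using central_measure_space(1)[OF P] .
  let ?L = "level rook_brauer_graph"
  have "AE \<omega> in P. \<omega> \<notin> {\<omega> \<in> space P. \<omega> n = \<gamma>}" if "\<gamma> \<in> {\<gamma> \<in> ?L n. card (snd \<gamma>) < n}" for n \<gamma>
  proof (rule prob_eq_0[THEN iffD1])
    show "{\<omega> \<in> space P. \<omega> n = \<gamma>} \<in> events"
      by (rule sets_coordinate_eq[OF central_measure_space(2)[OF P]])
    show "prob {\<omega> \<in> space P. \<omega> n = \<gamma>} = 0"
      using path_weight_mult_walk_count[of \<gamma> n P] path_weight_eq_0[OF P, of \<gamma> n] that by simp
  qed
  then have "AE \<omega> in P. \<forall>n. \<forall>\<gamma>\<in>{\<gamma> \<in> ?L n. card (snd \<gamma>) < n}. \<omega> \<notin> {\<omega> \<in> space P. \<omega> n = \<gamma>}"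
    using finite_level_rook_brauer
    by (intro AE_all_countable[THEN iffD2] allI AE_finite_allI) auto
  then have "AE \<omega> in P. \<omega> \<in> forward_paths"
  proof (rule AE_mp, intro AE_I2 impI)
    fix \<omega> assume \<omega>: "\<omega> \<in> space P"
      and avoid: "\<forall>n. \<forall>\<gamma>\<in>{\<gamma> \<in> ?L n. card (snd \<gamma>) < n}. \<omega> \<notin> {\<omega> \<in> space P. \<omega> n = \<gamma>}"
    have path: "\<omega> \<in> infinite_paths rook_brauer_graph"
      using \<omega> central_measure_space(3)[OF P] by simp
    have "card (snd (\<omega> n)) = n" for n
    proof -
      have level: "\<omega> n \<in> ?L n" by (rule infinite_paths_rook_brauerD(2)[OF path])
      then have "\<not> card (snd (\<omega> n)) < n" using avoid \<omega> by blast
      then show ?thesis using level by (simp add: mem_level_rook_brauer)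
    qed
    then show "\<omega> \<in> forward_paths" using path by (simp add: forward_paths_eq_card)
  qed
  then show ?thesis
    using forward_paths_measurable central_measure_space(2)[OF P] by (subst prob_eq_1) auto
qed

theorem theorem4p1:
  shows "bij_betw young_embedding (infinite_paths young_graph) forward_paths
    \<and> sets (restrict_space (path_space rook_brauer_graph) forward_paths) =
        (`) young_embedding ` sets (path_space young_graph)
    \<and> forward_paths =
        {\<omega> \<in> infinite_paths rook_brauer_graph. \<forall>n. card (snd (\<omega> n)) = n}
    \<and> forward_paths \<in> sets (path_space rook_brauer_graph)
    \<and> (\<forall>P :: (nat \<Rightarrow> nat \<times> diagram) measure.
         central_measure rook_brauer_graph P \<longrightarrow> measure P forward_paths = 1)"
  using bij_betw_young_embedding sets_forward_paths forward_paths_eq_card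
    forward_paths_measurable central_measure_forward_paths
  by (intro conjI allI impI)

end
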